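(* Let $(L,[\cdot,\cdot,\cdot])$ be a Lie triple system, $(M,\theta)$ a representation of it, and $\mathcal H$ a 3-cocycle of $L$ with coefficients in $(M,\theta)$. A linear map $T:M\to L$ is a generalized Reynolds operator if and only if $T$ (viewed as an element of $C^0(M,L)=\mathrm{Hom}(M,L)$) is a solution of the Maurer–Cartan equation of the $L_\infty$-algebra $(C^\ast(M,L),l_3,l_4)$, i.e. $$\frac1{3!}\,l_3(T,T,T)+\frac1{4!}\,l_4(T,T,T,T)=0 .$$
   Context: All vector spaces are over a field $\mathbb K$ of characteristic $0$. A Lie triple system (L.t.s.) is a vector space $L$ with a trilinear bracket satisfying $[x,x,y]=0$, $[x,y,z]+[y,z,x]+[z,x,y]=0$ and $[x,y,[z,t,e]]=[[x,y,z],t,e]+[z,[x,y,t],e]+[z,t,[x,y,e]]$ for all elements. A representation of $L$ on a vector space $M$ is a bilinear map $\theta:L\times L\to \mathrm{End}(M)$ such that, with $D(x,y):=\theta(y,x)-\theta(x,y)$, $\theta(z,t)\theta(x,y)-\theta(y,t)\theta(x,z)-\theta(x,[y,z,t])+D(y,z)\theta(x,t)=0$ and $\theta(z,t)D(x,y)-D(x,y)\theta(z,t)+\theta([x,y,z],t)+\theta(z,[x,y,t])=0$. A 3-cocycle is a trilinear map $\mathcal H:L\times L\times L\to M$ with $\mathcal H(x,x,y)=0$, $\mathcal H(x,y,z)+\mathcal H(y,z,x)+\mathcal H(z,x,y)=0$ and $\mathcal H(x_1,x_2,[y_1,y_2,y_3])+D(x_1,x_2)\mathcal H(y_1,y_2,y_3)-\mathcal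 H([x_1,x_2,y_1],y_2,y_3)-\mathcal H(y_1,[x_1,x_2,y_2],y_3)=\mathcal H(y_1,y_2,[x_1,x_2,y_3])+\theta(y_2,y_3)\mathcal H(x_1,x_2,y_1)-\theta(y_1,y_3)\mathcal H(x_1,x_2,y_2)+D(y_1,y_2)\mathcal H(x_1,x_2,y_3)$. A linear map $T:M\to L$ is a generalized Reynolds operator if for all $u,v,w\in M$ $[Tu,Tv,Tw]=T\big(D(Tu,Tv)w+\theta(Tv,Tw)u-\theta(Tu,Tw)v+\mathcal H(Tu,Tv,Tw)\big)$. For vector spaces $V,W$, let $C^n(V,W)$ ($n\ge0$) be the space of linear maps $P:(\wedge^2V)^{\otimes n}\otimes V\to W$ such that, for $n\ge1$, $P(\mathfrak X_1,\dots,\mathfrak X_{n-1},x,x,y)=0$ and $P(\mathfrak X_1,\dots,\mathfrak X_{n-1},x,y,z)+P(\mathfrak X_1,\dots,\mathfrak X_{n-1},y,z,x)+P(\mathfrak X_1,\dots,\mathfrak X_{n-1},z,x,y)=0$; elements of $C^n(V,W)$ have degree $n$. On $C^\ast(V,V)=\bigoplus_n C^n(V,V)$ there is a graded Lie bracket $[P,Q]_{L.t.s}=P\circ Q-(-1)^{pq}Q\circ P$ for $P\in C^p(V,V)$, $Q\in C^q(V,V)$, where, writing $\mathfrak X_i=x_i\wedge y_i$, $$\begin{aligned}(P\circ Q)&(\mathfrak X_1,\dots,\mathfrak X_{p+q},x)\\ =&\sum_{k=1}^p(-1)^{(k-1)q}\sum_{\sigma\in S(k-1,q)}(-1)^\sigma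 P(\mathfrak X_{\sigma(1)},\dots,\mathfrak X_{\sigma(k-1)},Q(\mathfrak X_{\sigma(k)},\dots,\mathfrak X_{\sigma(k+q-1)},x_{k+q})\wedge y_{k+q},\mathfrak X_{k+q+1},\dots,\mathfrak X_{p+q},x)\\ +&\sum_{k=1}^p(-1)^{(k-1)q}\sum_{\sigma\in S(k-1,q)}(-1)^\sigma P(\mathfrak X_{\sigma(1)},\dots,\mathfrak X_{\sigma(k-1)},x_{k+q}\wedge Q(\mathfrak X_{\sigma(k)},\dots,\mathfrak X_{\sigma(k+q-1)},y_{k+q}),\mathfrak X_{k+q+1},\dots,\mathfrak X_{p+q},x)\\ +&\sum_{\sigma\in S(p,q)}(-1)^{pq}(-1)^\sigma P(\mathfrak X_{\sigma(1)},\dots,\mathfrak X_{\sigma(p)},Q(\mathfrak X_{\sigma(p+1)},\dots,\mathfrak X_{\sigma(p+q)},x)).\end{aligned}$$ Here $S(i,j)$ is the set of $(i,j)$-shuffles: permutations $\sigma$ of $\{1,\dots,i+j\}$ with $\sigma(1)<\dots<\sigma(i)$ and $\sigma(i+1)<\dots<\sigma(i+j)$, and $(-1)^\sigma$ is the sign of $\sigma$. Apply this with $V=L\oplus M$. The elements $\pi+\theta,\mathcal H\in C^1(L\oplus M,L\oplus M)$ are $(\pi+\theta)(x+u,y+v,z+w)=[x,y,z]+\theta(y,z)u-\theta(x,z)v+D(x,y)w$ and $\mathcal H(x+u,y+v,z+w)=\mathcal H(x,y,z)$ for $x,y,z\in L$, $u,v,w\in M$. $C^n(M,L)$ is regarded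 as a subspace of $C^n(L\oplus M,L\oplus M)$ via extension by zero. The $L_\infty$-algebra $(C^\ast(M,L),l_3,l_4)$ has $C^\ast(M,L)=\bigoplus_{n\ge0}C^n(M,L)$, $l_3(P,Q,R)=[[[\pi+\theta,P]_{L.t.s},Q]_{L.t.s},R]_{L.t.s}$, $l_4(P,Q,R,S)=[[[[\mathcal H,P]_{L.t.s},Q]_{L.t.s},R]_{L.t.s},S]_{L.t.s}$ and all other operations zero. *)

theory Defs
  imports "HOL-Analysis.Product_Vector" "HOL-Combinatorics.Permutations"
begin

section \<open>Lie triple systems, representations and 3-cocycles\<close>

definition trilinear ::
  "('k::field \<Rightarrow> 'a::ab_group_add \<Rightarrow> 'a) \<Rightarrow> ('k \<Rightarrow> 'b::ab_group_add \<Rightarrow> 'b) \<Rightarrow>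
   ('a \<Rightarrow> 'a \<Rightarrow> 'a \<Rightarrow> 'b) \<Rightarrow> bool" where
  "trilinear sa sb f \<longleftrightarrow>
     (\<forall>y z. Vector_Spaces.linear sa sb (\<lambda>x. f x y z)) \<and>
     (\<forall>x z. Vector_Spaces.linear sa sb (\<lambda>y. f x y z)) \<and>
     (\<forall>x y. Vector_Spaces.linear sa sb (\<lambda>z. f x y z))"

locale lie_triple_system = vector_space scale
  for scale :: "'k::field_char_0 \<Rightarrow> 'l::ab_group_add \<Rightarrow> 'l" +
  fixes bracket :: "'l \<Rightarrow> 'l \<Rightarrow> 'l \<Rightarrow> 'l"
  assumes bracket_trilinear: "trilinear scale scale bracket"
    and bracket_alt: "bracket x x y = 0"
    and bracket_cyclic: "bracket x y z + bracket y z x + bracket z x y = 0"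
    and bracket_derivation:
      "bracket x y (bracket z t e) =
         bracket (bracket x y z) t e + bracket z (bracket x y t) e + bracket z t (bracket x y e)"

definition rep_D :: "('l \<Rightarrow> 'l \<Rightarrow> 'm \<Rightarrow> 'm::ab_group_add) \<Rightarrow> 'l \<Rightarrow> 'l \<Rightarrow> 'm \<Rightarrow> 'm" where
  "rep_D \<theta> x y u = \<theta> y x u - \<theta> x y u"

locale lts_representation =
  L: lie_triple_system scaleL bracket + M: vector_space scaleM
  for scaleL :: "'k::field_char_0 \<Rightarrow> 'l::ab_group_add \<Rightarrow> 'l"
    and bracket :: "'l \<Rightarrow> 'l \<Rightarrow> 'l \<Rightarrow> 'l"
    and scaleM :: "'k \<Rightarrow> 'm::ab_group_add \<Rightarrow> 'm" +
  fixes \<theta> :: "'l \<Rightarrow> 'l \<Rightarrow> 'm \<Rightarrow> 'm"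
  assumes rep_endo: "Vector_Spaces.linear scaleM scaleM (\<theta> x y)"
    and rep_linear_left: "Vector_Spaces.linear scaleL scaleM (\<lambda>x. \<theta> x y u)"
    and rep_linear_right: "Vector_Spaces.linear scaleL scaleM (\<lambda>y. \<theta> x y u)"
    and rep_ax1:
      "\<theta> z t (\<theta> x y u) - \<theta> y t (\<theta> x z u) - \<theta> x (bracket y z t) u + rep_D \<theta> y z (\<theta> x t u) = 0"
    and rep_ax2:
      "\<theta> z t (rep_D \<theta> x y u) - rep_D \<theta> x y (\<theta> z t u)
         + \<theta> (bracket x y z) t u + \<theta> z (bracket x y t) u = 0"

locale lts_3_cocycle = lts_representation scaleL bracket scaleM \<theta>
  for scaleL :: "'k::field_char_0 \<Rightarrow> 'l::ab_group_add \<Rightarrow> 'l"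
    and bracket :: "'l \<Rightarrow> 'l \<Rightarrow> 'l \<Rightarrow> 'l"
    and scaleM :: "'k \<Rightarrow> 'm::ab_group_add \<Rightarrow> 'm"
    and \<theta> :: "'l \<Rightarrow> 'l \<Rightarrow> 'm \<Rightarrow> 'm" +
  fixes H :: "'l \<Rightarrow> 'l \<Rightarrow> 'l \<Rightarrow> 'm"
  assumes cocycle_trilinear: "trilinear scaleL scaleM H"
    and cocycle_alt: "H x x y = 0"
    and cocycle_cyclic: "H x y z + H y z x + H z x y = 0"
    and cocycle_closed:
      "H x1 x2 (bracket y1 y2 y3) + rep_D \<theta> x1 x2 (H y1 y2 y3)
         - H (bracket x1 x2 y1) y2 y3 - H y1 (bracket x1 x2 y2) y3
       = H y1 y2 (bracket x1 x2 y3) + \<theta> y2 y3 (H x1 x2 y1)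
         - \<theta> y1 y3 (H x1 x2 y2) + rep_D \<theta> y1 y2 (H x1 x2 y3)"

definition generalized_Reynolds_operator ::
  "('k::field \<Rightarrow> 'l::ab_group_add \<Rightarrow> 'l) \<Rightarrow> ('l \<Rightarrow> 'l \<Rightarrow> 'l \<Rightarrow> 'l) \<Rightarrow>
   ('k \<Rightarrow> 'm::ab_group_add \<Rightarrow> 'm) \<Rightarrow> ('l \<Rightarrow> 'l \<Rightarrow> 'm \<Rightarrow> 'm) \<Rightarrow> ('l \<Rightarrow> 'l \<Rightarrow> 'l \<Rightarrow> 'm) \<Rightarrow>
   ('m \<Rightarrow> 'l) \<Rightarrow> bool" where
  "generalized_Reynolds_operator scaleL bracket scaleM \<theta> H T \<longleftrightarrow>
     Vector_Spaces.linear scaleM scaleL T \<and>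
     (\<forall>u v w. bracket (T u) (T v) (T w) =
        T (rep_D \<theta> (T u) (T v) w + \<theta> (T v) (T w) u - \<theta> (T u) (T w) v + H (T u) (T v) (T w)))"


section \<open>Cochains and the graded Lie bracket\<close>

text \<open>
  A linear map on the tensor product of \<open>n\<close> copies of the exterior square of \<open>V\<close> and one copy of
  \<open>V\<close> is the same as a multilinear map in \<open>2n + 1\<close> arguments that is alternating in each of the
  first \<open>n\<close> pairs. The pairs \<open>x\<^sub>i \<and> y\<^sub>i\<close> are passed as a list. An element of the direct sum over
  all degrees is a function on lists of arbitrary length whose restriction to lists of
  length \<open>n\<close> is its component of degree \<open>n\<close>; a homogeneous element of degree \<open>n\<close> vanishes on
  lists of any other length.
\<close>

type_synonym ('v, 'w) cochain = "('v \<times> 'v) list \<Rightarrow> 'v \<Rightarrow> 'w"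

definition cochains ::
  "('k::field \<Rightarrow> 'v::ab_group_add \<Rightarrow> 'v) \<Rightarrow> ('k \<Rightarrow> 'w::ab_group_add \<Rightarrow> 'w) \<Rightarrow> nat \<Rightarrow>
   ('v, 'w) cochain set" where
  "cochains sv sw n = {P.
     (\<forall>Xs z. length Xs \<noteq> n \<longrightarrow> P Xs z = 0) \<and>
     (\<forall>Xs. length Xs = n \<longrightarrow> Vector_Spaces.linear sv sw (P Xs)) \<and>
     (\<forall>Xs i z. length Xs = n \<and> i < n \<longrightarrow>
        (\<forall>y. Vector_Spaces.linear sv sw (\<lambda>x. P (Xs[i := (x, y)]) z)) \<and>
        (\<forall>x. Vector_Spaces.linear sv sw (\<lambda>y. P (Xs[i := (x, y)]) z)) \<and>
        (\<forall>x. P (Xs[i := (x, x)]) z = 0)) \<and>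
     (\<forall>Xs x y z. Suc (length Xs) = n \<longrightarrow>
        P (Xs @ [(x, x)]) y = 0 \<and>
        P (Xs @ [(x, y)]) z + P (Xs @ [(y, z)]) x + P (Xs @ [(z, x)]) y = 0)}"

definition shuffle_perms :: "nat \<Rightarrow> nat \<Rightarrow> (nat \<Rightarrow> nat) set" where
  "shuffle_perms i j =
     {\<sigma>. \<sigma> permutes {..<i + j} \<and> strict_mono_on {..<i} \<sigma> \<and> strict_mono_on {i..<i + j} \<sigma>}"

text \<open>
  The product \<open>P \<circ> Q\<close> of the component of \<open>P\<close> of degree \<open>p\<close> with the component of \<open>Q\<close> of degree
  \<open>q\<close>, evaluated at \<open>p + q\<close> pairs \<open>Xs\<close> and a vector \<open>x\<close>. Positions in \<open>Xs\<close> count from \<open>0\<close>, so \<open>k\<close>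
  below is \<open>k - 1\<close> in the usual formula with \<open>1 \<le> k \<le> p\<close>.
\<close>

definition circ ::
  "('k::field \<Rightarrow> 'v::ab_group_add \<Rightarrow> 'v) \<Rightarrow> nat \<Rightarrow> nat \<Rightarrow> ('v, 'v) cochain \<Rightarrow> ('v, 'v) cochain \<Rightarrow>
   ('v, 'v) cochain" where
  "circ s p q P Q Xs x =
     (\<Sum>k<p. s ((-1) ^ (k * q)) (\<Sum>\<sigma>\<in>shuffle_perms k q. s (of_int (sign \<sigma>))
        (P (map (\<lambda>i. Xs ! \<sigma> i) [0..<k]
            @ (Q (map (\<lambda>i. Xs ! \<sigma> i) [k..<k + q]) (fst (Xs ! (k + q))), snd (Xs ! (k + q)))
            # drop (k + q + 1) Xs) x)))
   + (\<Sum>k<p. s ((-1) ^ (k * q)) (\<Sum>\<sigma>\<in>shuffle_perms k q. s (of_int (sign \<sigma>))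
        (P (map (\<lambda>i. Xs ! \<sigma> i) [0..<k]
            @ (fst (Xs ! (k + q)), Q (map (\<lambda>i. Xs ! \<sigma> i) [k..<k + q]) (snd (Xs ! (k + q))))
            # drop (k + q + 1) Xs) x)))
   + (\<Sum>\<sigma>\<in>shuffle_perms p q. s ((-1) ^ (p * q) * of_int (sign \<sigma>))
        (P (map (\<lambda>i. Xs ! \<sigma> i) [0..<p]) (Q (map (\<lambda>i. Xs ! \<sigma> i) [p..<p + q]) x)))"

text \<open>
  The bracket on the whole direct sum: its component of degree \<open>n\<close> is the sum of the brackets of
  the components of degrees \<open>p\<close> and \<open>q\<close> over all \<open>p + q = n\<close>.
\<close>

definition lts_bracket ::
  "('k::field \<Rightarrow> 'v::ab_group_add \<Rightarrow> 'v) \<Rightarrow> ('v, 'v) cochain \<Rightarrow> ('v, 'v) cochain \<Rightarrow>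
   ('v, 'v) cochain" where
  "lts_bracket s P Q Xs x =
     (\<Sum>(p, q) \<in> {(p, q). p + q = length Xs}.
        circ s p q P Q Xs x - s ((-1) ^ (p * q)) (circ s q p Q P Xs x))"


section \<open>The operations on \<open>C\<^sup>*(M, L)\<close> and the Maurer--Cartan equation\<close>

definition structure_cochain ::
  "('l \<Rightarrow> 'l \<Rightarrow> 'l \<Rightarrow> 'l) \<Rightarrow> ('l \<Rightarrow> 'l \<Rightarrow> 'm \<Rightarrow> 'm) \<Rightarrow>
   ('l::ab_group_add \<times> 'm::ab_group_add, 'l \<times> 'm) cochain" where
  "structure_cochain bracket \<theta> Xs c =
     (case Xs of
        [((x, u), (y, v))] \<Rightarrow>
          (let (z, w) = c in (bracket x y z, \<theta> y z u - \<theta> x z v + rep_D \<theta> x y w))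
      | _ \<Rightarrow> 0)"

definition cocycle_cochain ::
  "('l \<Rightarrow> 'l \<Rightarrow> 'l \<Rightarrow> 'm) \<Rightarrow> ('l::ab_group_add \<times> 'm::ab_group_add, 'l \<times> 'm) cochain" where
  "cocycle_cochain H Xs c =
     (case Xs of
        [((x, u), (y, v))] \<Rightarrow> (let (z, w) = c in (0, H x y z))
      | _ \<Rightarrow> 0)"

definition extend_by_zero ::
  "('m, 'l) cochain \<Rightarrow> ('l::ab_group_add \<times> 'm::ab_group_add, 'l \<times> 'm) cochain" where
  "extend_by_zero P Xs c = (P (map (map_prod snd snd) Xs) (snd c), 0)"

text \<open>
  The values of \<open>l3\<close> and \<open>l4\<close> are the iterated brackets themselves, that is, cochains on the direct
  sum of \<open>L\<close> and \<open>M\<close>, of which \<open>C\<^sup>*(M, L)\<close> is regarded as a subspace via \<^const>\<open>extend_by_zero\<close>.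
\<close>

definition l3 ::
  "('k::field \<Rightarrow> 'l::ab_group_add \<Rightarrow> 'l) \<Rightarrow> ('l \<Rightarrow> 'l \<Rightarrow> 'l \<Rightarrow> 'l) \<Rightarrow>
   ('k \<Rightarrow> 'm::ab_group_add \<Rightarrow> 'm) \<Rightarrow> ('l \<Rightarrow> 'l \<Rightarrow> 'm \<Rightarrow> 'm) \<Rightarrow>
   ('m, 'l) cochain \<Rightarrow> ('m, 'l) cochain \<Rightarrow> ('m, 'l) cochain \<Rightarrow>
   ('l \<times> 'm, 'l \<times> 'm) cochain" where
  "l3 scaleL bracket scaleM \<theta> P Q R =
     (let br = lts_bracket (module_prod.scale scaleL scaleM) in
      br (br (br (structure_cochain bracket \<theta>) (extend_by_zero P)) (extend_by_zero Q))
         (extend_by_zero R))"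

definition l4 ::
  "('k::field \<Rightarrow> 'l::ab_group_add \<Rightarrow> 'l) \<Rightarrow> ('k \<Rightarrow> 'm::ab_group_add \<Rightarrow> 'm) \<Rightarrow>
   ('l \<Rightarrow> 'l \<Rightarrow> 'l \<Rightarrow> 'm) \<Rightarrow>
   ('m, 'l) cochain \<Rightarrow> ('m, 'l) cochain \<Rightarrow> ('m, 'l) cochain \<Rightarrow> ('m, 'l) cochain \<Rightarrow>
   ('l \<times> 'm, 'l \<times> 'm) cochain" where
  "l4 scaleL scaleM H P Q R S =
     (let br = lts_bracket (module_prod.scale scaleL scaleM) in
      br (br (br (br (cocycle_cochain H) (extend_by_zero P)) (extend_by_zero Q))
         (extend_by_zero R)) (extend_by_zero S))"

definition Maurer_Cartan_solution ::
  "('k::field_char_0 \<Rightarrow> 'l::ab_group_add \<Rightarrow> 'l) \<Rightarrow> ('l \<Rightarrow> 'l \<Rightarrow> 'l \<Rightarrow> 'l) \<Rightarrow>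
   ('k \<Rightarrow> 'm::ab_group_add \<Rightarrow> 'm) \<Rightarrow> ('l \<Rightarrow> 'l \<Rightarrow> 'm \<Rightarrow> 'm) \<Rightarrow> ('l \<Rightarrow> 'l \<Rightarrow> 'l \<Rightarrow> 'm) \<Rightarrow>
   ('m, 'l) cochain \<Rightarrow> bool" where
  "Maurer_Cartan_solution scaleL bracket scaleM \<theta> H \<alpha> \<longleftrightarrow>
     \<alpha> \<in> cochains scaleM scaleL 0 \<and>
     (\<forall>Xs c. module_prod.scale scaleL scaleM (1 / fact 3)
                (l3 scaleL bracket scaleM \<theta> \<alpha> \<alpha> \<alpha> Xs c)
            + module_prod.scale scaleL scaleM (1 / fact 4)
                (l4 scaleL scaleM H \<alpha> \<alpha> \<alpha> \<alpha> Xs c) = 0)"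

definition cochain_of_map :: "('m \<Rightarrow> 'l) \<Rightarrow> ('m, 'l::zero) cochain" where
  "cochain_of_map T Xs u = (if Xs = [] then T u else 0)"

end

theory Submission
  imports Defs
begin

text \<open>
  Let \<open>t\<close> be the endomorphism \<open>(x, u) \<mapsto> (T u, 0)\<close> of \<open>L \<oplus> M\<close>, so that \<open>t \<circ> t = 0\<close>. Bracketing a
  trilinear map \<open>F\<close> with \<open>t\<close>, seen as a cochain of degree 0, gives the trilinear map

  \<open>F(ta, b, c) + F(a, tb, c) + F(a, b, tc) - t F(a, b, c)\<close>

  (lemma \<open>lts_bracket_endomorphism\<close>). This is the sum of four operations on trilinear maps:
  substituting \<open>t\<close> in one of the three arguments, and applying \<open>-t\<close> to the value. They commute
  with each other, and each squares to zero because \<open>t\<close> does. Hence the \<open>n\<close>-th power of their sum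
  is \<open>n!\<close> times their \<open>n\<close>-th elementary symmetric polynomial; the factorials cancel the
  coefficients of the Maurer--Cartan equation. What remains is

  \<open>(\<pi> + \<theta>)(ta, tb, tc) - t ((\<pi> + \<theta>)(ta, tb, c) + (\<pi> + \<theta>)(ta, b, tc) + (\<pi> + \<theta>)(a, tb, tc))
    - t H(ta, tb, tc)\<close>.

  For \<open>a = (x, u)\<close>, \<open>b = (y, v)\<close>, \<open>c = (z, w)\<close> the component of this vector in \<open>M\<close> is zero, and
  its component in \<open>L\<close> is the difference of the two sides of the equation that defines a
  generalized Reynolds operator.
\<close>

section \<open>Bracketing a cochain of degree one with an endomorphism\<close>

definition cochain_of_ternary :: "('v \<Rightarrow> 'v \<Rightarrow> 'v \<Rightarrow> 'w) \<Rightarrow> ('v, 'w::zero) cochain" where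
  "cochain_of_ternary F Xs c = (case Xs of [(a, b)] \<Rightarrow> F a b c | _ \<Rightarrow> 0)"

lemma cochain_of_ternary_single [simp]: "cochain_of_ternary F [(a, b)] c = F a b c"
  by (simp add: cochain_of_ternary_def)

lemma cochain_of_ternary_other [simp]:
  "length Xs \<noteq> Suc 0 \<Longrightarrow> cochain_of_ternary F Xs c = 0"
  by (auto simp: cochain_of_ternary_def split: list.split)

lemma cochain_of_map_Nil [simp]: "cochain_of_map t [] x = t x"
  by (simp add: cochain_of_map_def)

lemma cochain_of_map_other [simp]: "Xs \<noteq> [] \<Longrightarrow> cochain_of_map t Xs x = 0"
  by (simp add: cochain_of_map_def)

text \<open>
  This consequence of trilinearity makes a summand of a bracket vanish in which a zero component
  of the other cochain is inserted into an argument of \<open>F\<close>. Bracketing with an endomorphism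
  preserves it, so that the brackets can be iterated.
\<close>

definition vanishes_at_zero :: "('v::zero \<Rightarrow> 'v \<Rightarrow> 'v \<Rightarrow> 'w::zero) \<Rightarrow> bool" where
  "vanishes_at_zero F \<longleftrightarrow> (\<forall>a b. F 0 a b = 0 \<and> F a 0 b = 0 \<and> F a b 0 = 0)"

lemma shuffle_perms_trivial:
  "shuffle_perms 0 0 = {id}" "shuffle_perms (Suc 0) 0 = {id}" "shuffle_perms 0 (Suc 0) = {id}"
  by (auto simp: shuffle_perms_def lessThan_Suc strict_mono_on_def)

lemmas linear_map_zero = module_hom.zero[OF module_hom_linearI]
  and linear_map_add = module_hom.add[OF module_hom_linearI]
  and linear_map_diff = module_hom.diff[OF module_hom_linearI]
  and linear_map_scale = module_hom.scale[OF module_hom_linearI]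

context vector_space
begin

text \<open>
  The component of degree \<open>n\<close> of a bracket is a sum over all splittings \<open>n = p + q\<close>; for
  homogeneous arguments the three lemmas about vanishing components leave only the splitting into
  their degrees.
\<close>

lemma circ_eq_0_if_left_component_0:
  assumes "\<And>Ys y. length Ys = p \<Longrightarrow> P Ys y = 0" "p + q = length Xs"
  shows "circ scale p q P Q Xs x = 0"
proof -
  have "P (map f [0..<k] @ Y # drop (k + q + 1) Xs) y = 0" if "k < p" for f k Y y
    using that assms(2) by (intro assms(1)) simp
  moreover have "P (map f [0..<p]) y = 0" for f y
    by (intro assms(1)) simp
  ultimately show ?thesis
    unfolding circ_def by simp
qed

lemma circ_ternary_eq_0_if_right_component_0:
  assumes "\<And>Ys y. length Ys = q \<Longrightarrow> Q Ys y = 0" "vanishes_at_zero F" "p + q = length Xs"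
  shows "circ scale p q (cochain_of_ternary F) Q Xs x = 0"
proof (cases "p = Suc 0")
  case True
  have "Q (map f [k..<k + q]) y = 0" for f k y
    by (intro assms(1)) simp
  moreover have "Q (map f [0..<q]) y = 0" for f y
    by (intro assms(1)) simp
  moreover have "drop (q + 1) Xs = []"
    using assms(3) True by simp
  moreover have "cochain_of_ternary F Ys 0 = 0" for Ys
    using assms(2) by (auto simp: cochain_of_ternary_def vanishes_at_zero_def split: list.split)
  moreover have "Q (map f [Suc 0..<Suc q]) y = 0" for f y
    by (intro assms(1)) simp
  ultimately show ?thesis
    using assms(2) True by (simp add: circ_def vanishes_at_zero_def)
next
  case False
  then show ?thesis
    using assms(3) by (intro circ_eq_0_if_left_component_0) auto
qed

lemma circ_map_eq_0_if_right_component_0: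
  assumes "\<And>Ys y. length Ys = q \<Longrightarrow> Q Ys y = 0" "t 0 = 0" "p + q = length Xs"
  shows "circ scale p q (cochain_of_map t) Q Xs x = 0"
proof (cases "p = 0")
  case True
  have "Q (map f [0..<q]) y = 0" for f y
    by (intro assms(1)) simp
  then show ?thesis
    using True assms(2) by (simp add: circ_def)
next
  case False
  then show ?thesis
    using assms(3) by (intro circ_eq_0_if_left_component_0) auto
qed

end

locale square_zero_endomorphism = vector_space scale
  for scale :: "'k::field_char_0 \<Rightarrow> 'v::ab_group_add \<Rightarrow> 'v" +
  fixes t :: "'v \<Rightarrow> 'v"
  assumes linear_t: "Vector_Spaces.linear scale scale t"
    and t_t [simp]: "t (t a) = 0"
begin

lemma t_zero [simp]: "t 0 = 0"
  by (rule linear_map_zero[OF linear_t])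

lemma t_add: "t (a + b) = t a + t b"
  by (rule linear_map_add[OF linear_t])

lemma t_diff: "t (a - b) = t a - t b"
  by (rule linear_map_diff[OF linear_t])

lemma t_scale: "t (scale r a) = scale r (t a)"
  by (rule linear_map_scale[OF linear_t])

definition derivation_defect :: "('v \<Rightarrow> 'v \<Rightarrow> 'v \<Rightarrow> 'v) \<Rightarrow> 'v \<Rightarrow> 'v \<Rightarrow> 'v \<Rightarrow> 'v" where
  "derivation_defect F a b c = F (t a) b c + F a (t b) c + F a b (t c) - t (F a b c)"

lemma vanishes_at_zero_derivation_defect:
  "vanishes_at_zero F \<Longrightarrow> vanishes_at_zero (derivation_defect F)"
  by (simp add: vanishes_at_zero_def derivation_defect_def)

lemma lts_bracket_endomorphism:
  assumes F: "vanishes_at_zero F"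
  shows "lts_bracket scale (cochain_of_ternary F) (cochain_of_map t)
           = cochain_of_ternary (derivation_defect F)"
proof (intro ext)
  fix Xs :: "('v \<times> 'v) list" and x :: 'v
  let ?F = "cochain_of_ternary F" and ?t = "cochain_of_map t"
  have Ft: "circ scale p q ?F ?t Xs x = 0" if "p + q = length Xs" "(p, q) \<noteq> (Suc 0, 0)" for p q
  proof (cases "q = 0")
    case True
    with that show ?thesis
      by (intro circ_eq_0_if_left_component_0) auto
  next
    case False
    with that F show ?thesis
      by (intro circ_ternary_eq_0_if_right_component_0) auto
  qed
  have tF: "circ scale q p ?t ?F Xs x = 0" if "p + q = length Xs" "(p, q) \<noteq> (Suc 0, 0)" for p q
  proof (cases "q = 0")
    case True
    with that show ?thesis
      by (intro circ_map_eq_0_if_right_component_0) auto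
  next
    case False
    with that show ?thesis
      by (intro circ_eq_0_if_left_component_0) auto
  qed
  show "lts_bracket scale ?F ?t Xs x = cochain_of_ternary (derivation_defect F) Xs x"
  proof (cases "length Xs = Suc 0")
    case True
    then obtain a b where Xs: "Xs = [(a, b)]"
      by (cases Xs) auto
    have splittings: "{(p, q). p + q = Suc 0} = {(Suc 0, 0), (0, Suc 0)}"
      by auto
    have "circ scale (Suc 0) 0 ?F ?t Xs x = F (t a) b x + F a (t b) x + F a b (t x)"
      by (simp add: circ_def Xs shuffle_perms_trivial sign_id)
    moreover have "circ scale 0 (Suc 0) ?t ?F Xs x = t (F a b x)"
      by (simp add: circ_def Xs shuffle_perms_trivial sign_id)
    moreover have "circ scale 0 (Suc 0) ?F ?t Xs x = 0" "circ scale (Suc 0) 0 ?t ?F Xs x = 0"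
      using Ft[of 0 "Suc 0"] tF[of 0 "Suc 0"] True by auto
    ultimately show ?thesis
      by (simp add: lts_bracket_def splittings True) (simp add: Xs derivation_defect_def)
  next
    case False
    then have "(p, q) \<noteq> (Suc 0, 0)" if "p + q = length Xs" for p q
      using that by auto
    then have "lts_bracket scale ?F ?t Xs x = 0"
      unfolding lts_bracket_def by (intro sum.neutral) (auto simp: Ft tF)
    with False show ?thesis
      by simp
  qed
qed

section \<open>Iterated brackets with a square-zero endomorphism\<close>

text \<open>
  Since the four summands of \<^const>\<open>derivation_defect\<close> commute and square to zero, only the
  products of distinct summands survive in a power, each as often as there are orders of its
  factors: 2, 6 and 24 times. The minus signs come from the summand \<open>- t (F a b c)\<close>.
\<close>

lemma derivation_defect_power2:
  assumes "vanishes_at_zero F"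
  shows "(derivation_defect ^^ 2) F a b c = scale 2
     (F (t a) (t b) c + F (t a) b (t c) + F a (t b) (t c)
       - t (F (t a) b c + F a (t b) c + F a b (t c)))"
  using assms scale_left_distrib[of 1 1]
  by (simp add: numeral_2_eq_2 derivation_defect_def vanishes_at_zero_def t_add t_diff
      algebra_simps)

lemma derivation_defect_power3:
  assumes "vanishes_at_zero F"
  shows "(derivation_defect ^^ 3) F a b c = scale 6
     (F (t a) (t b) (t c) - t (F (t a) (t b) c + F (t a) b (t c) + F a (t b) (t c)))"
proof -
  have "(derivation_defect ^^ 3) F = derivation_defect ((derivation_defect ^^ 2) F)"
    by (simp add: numeral_eq_Suc)
  moreover have "scale 6 x = scale 2 x + scale 2 x + scale 2 x" for x
    by (simp flip: scale_left_distrib)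
  ultimately show ?thesis
    using assms
    by (simp add: derivation_defect_def[of "(derivation_defect ^^ 2) F"] derivation_defect_power2
        vanishes_at_zero_def t_add t_diff t_scale
        scale_right_distrib scale_right_diff_distrib algebra_simps)
qed

lemma derivation_defect_power4:
  assumes "vanishes_at_zero F"
  shows "(derivation_defect ^^ 4) F a b c = scale (- 24) (t (F (t a) (t b) (t c)))"
proof -
  have "(derivation_defect ^^ 4) F = derivation_defect ((derivation_defect ^^ 3) F)"
    by (simp add: numeral_eq_Suc)
  moreover have "scale 24 x = scale 6 x + scale 6 x + scale 6 x + scale 6 x" for x
    by (simp flip: scale_left_distrib)
  ultimately show ?thesis
    using assms
    by (simp add: derivation_defect_def[of "(derivation_defect ^^ 3) F"] derivation_defect_power3
        vanishes_at_zero_def t_add t_diff t_scale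
        scale_right_distrib scale_right_diff_distrib algebra_simps)
qed

end

section \<open>The Maurer--Cartan equation\<close>

lemma trilinear_vanishes_at_zero:
  assumes "trilinear sa sb f"
  shows "f 0 y z = 0" "f x 0 z = 0" "f x y 0 = 0"
  using assms linear_map_zero
  unfolding trilinear_def by metis+

lemma structure_cochain_eq_ternary:
  "structure_cochain bracket \<theta> = cochain_of_ternary (\<lambda>a b c.
     (bracket (fst a) (fst b) (fst c),
      \<theta> (fst b) (fst c) (snd a) - \<theta> (fst a) (fst c) (snd b) + rep_D \<theta> (fst a) (fst b) (snd c)))"
  by (intro ext)
    (auto simp: structure_cochain_def cochain_of_ternary_def split: list.split prod.split)

lemma cocycle_cochain_eq_ternary:
  "cocycle_cochain H = cochain_of_ternary (\<lambda>a b c. (0, H (fst a) (fst b) (fst c)))"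
  by (intro ext)
    (auto simp: cocycle_cochain_def cochain_of_ternary_def zero_prod_def
      split: list.split prod.split)

lemma extend_by_zero_cochain_of_map:
  "extend_by_zero (cochain_of_map T) = cochain_of_map (\<lambda>c. (T (snd c), 0))"
  by (intro ext) (simp add: extend_by_zero_def cochain_of_map_def zero_prod_def)

lemma cochain_of_map_in_cochains:
  assumes "Vector_Spaces.linear sv sw T"
  shows "cochain_of_map T \<in> cochains sv sw 0"
proof -
  have "cochain_of_map T [] = T"
    by auto
  with assms show ?thesis
    by (simp add: cochains_def)
qed

theorem theorem4p5:
  fixes scaleL :: "'k::field_char_0 \<Rightarrow> 'l::ab_group_add \<Rightarrow> 'l"
    and bracket :: "'l \<Rightarrow> 'l \<Rightarrow> 'l \<Rightarrow> 'l"
    and scaleM :: "'k \<Rightarrow> 'm::ab_group_add \<Rightarrow> 'm"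
    and \<theta> :: "'l \<Rightarrow> 'l \<Rightarrow> 'm \<Rightarrow> 'm"
    and H :: "'l \<Rightarrow> 'l \<Rightarrow> 'l \<Rightarrow> 'm"
    and T :: "'m \<Rightarrow> 'l"
  assumes "lie_triple_system scaleL bracket"
    and "lts_representation scaleL bracket scaleM \<theta>"
    and "lts_3_cocycle scaleL bracket scaleM \<theta> H"
    and "Vector_Spaces.linear scaleM scaleL T"
  shows "generalized_Reynolds_operator scaleL bracket scaleM \<theta> H T \<longleftrightarrow>
         Maurer_Cartan_solution scaleL bracket scaleM \<theta> H (cochain_of_map T)"
proof -
  interpret lts_3_cocycle scaleL bracket scaleM \<theta> H
    by fact
  interpret prod: vector_space_prod scaleL scaleM
    by unfold_locales
  define t :: "'l \<times> 'm \<Rightarrow> 'l \<times> 'm" where "t = (\<lambda>c. (T (snd c), 0))"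
  define F where "F = (\<lambda>(a::'l \<times> 'm) (b::'l \<times> 'm) (c::'l \<times> 'm).
    (bracket (fst a) (fst b) (fst c),
     \<theta> (fst b) (fst c) (snd a) - \<theta> (fst a) (fst c) (snd b) + rep_D \<theta> (fst a) (fst b) (snd c)))"
  define K where "K = (\<lambda>(a::'l \<times> 'm) (b::'l \<times> 'm) (c::'l \<times> 'm).
    (0 :: 'l, H (fst a) (fst b) (fst c)))"

  note T = linear_map_zero[OF assms(4)] linear_map_add[OF assms(4)] linear_map_scale[OF assms(4)]
    linear_map_diff[OF assms(4)]
  note \<theta>_0 = linear_map_zero[OF rep_endo] linear_map_zero[OF rep_linear_left]
    linear_map_zero[OF rep_linear_right]

  have "Vector_Spaces.linear prod.scale prod.scale t"
    unfolding linear_iff_module_hom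
    by unfold_locales (simp_all add: t_def T prod.scale_def)
  moreover have "t (t a) = 0" for a
    by (simp add: t_def T zero_prod_def)
  ultimately interpret square_zero_endomorphism prod.scale t
    by (intro square_zero_endomorphism.intro square_zero_endomorphism_axioms.intro
        prod.p.vector_space_axioms)

  have F: "vanishes_at_zero F"
    by (simp add: F_def vanishes_at_zero_def rep_D_def \<theta>_0 zero_prod_def
        trilinear_vanishes_at_zero[OF L.bracket_trilinear])
  have K: "vanishes_at_zero K"
    by (simp add: K_def vanishes_at_zero_def zero_prod_def
        trilinear_vanishes_at_zero[OF cocycle_trilinear])

  have l3: "l3 scaleL bracket scaleM \<theta> (cochain_of_map T) (cochain_of_map T) (cochain_of_map T)
      = cochain_of_ternary ((derivation_defect ^^ 3) F)"
    unfolding l3_def Let_def structure_cochain_eq_ternary extend_by_zero_cochain_of_map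
    by (simp add: lts_bracket_endomorphism vanishes_at_zero_derivation_defect F numeral_3_eq_3
        flip: F_def t_def)
  have l4: "l4 scaleL scaleM H
        (cochain_of_map T) (cochain_of_map T) (cochain_of_map T) (cochain_of_map T)
      = cochain_of_ternary ((derivation_defect ^^ 4) K)"
    unfolding l4_def Let_def cocycle_cochain_eq_ternary extend_by_zero_cochain_of_map
    by (simp add: lts_bracket_endomorphism vanishes_at_zero_derivation_defect K numeral_eq_Suc
        flip: K_def t_def)

  define defect where "defect u v w = bracket (T u) (T v) (T w) -
    T (rep_D \<theta> (T u) (T v) w + \<theta> (T v) (T w) u - \<theta> (T u) (T w) v + H (T u) (T v) (T w))"
    for u v w
  define MC where "MC Xs c =
      prod.scale (1 / fact 3) (cochain_of_ternary ((derivation_defect ^^ 3) F) Xs c)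
    + prod.scale (1 / fact 4) (cochain_of_ternary ((derivation_defect ^^ 4) K) Xs c)"
    for Xs c
  have MC_single: "MC [(a, b)] c = (defect (snd a) (snd b) (snd c), 0)" for a b c
  proof -
    have "MC [(a, b)] c = F (t a) (t b) (t c)
        - t (F (t a) (t b) c + F (t a) b (t c) + F a (t b) (t c)) - t (K (t a) (t b) (t c))"
      by (simp add: MC_def derivation_defect_power3 derivation_defect_power4 F K fact_numeral)
    \<comment> \<open>A value of \<open>t\<close> has no component in \<open>M\<close>; so each of the three terms of \<open>F\<close> with two
      arguments \<open>t\<close> contributes one of the terms with \<open>\<theta>\<close>, and the term with three
      arguments \<open>t\<close> contributes the bracket of \<open>L\<close>.\<close>
    also have "\<dots> = (defect (snd a) (snd b) (snd c), 0)"
      by (simp add: t_def F_def K_def defect_def rep_D_def T \<theta>_0)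
    finally show ?thesis .
  qed
  have MC_other: "MC Xs c = 0" if "length Xs \<noteq> Suc 0" for Xs c
    using that by (simp add: MC_def)

  have "Maurer_Cartan_solution scaleL bracket scaleM \<theta> H (cochain_of_map T)
      \<longleftrightarrow> (\<forall>Xs c. MC Xs c = 0)"
    by (simp add: Maurer_Cartan_solution_def l3 l4 MC_def cochain_of_map_in_cochains assms(4))
  also have "\<dots> \<longleftrightarrow> (\<forall>u v w. defect u v w = 0)"
  proof
    assume *: "\<forall>Xs c. MC Xs c = 0"
    show "\<forall>u v w. defect u v w = 0"
    proof (intro allI)
      fix u v w
      \<comment> \<open>The value of \<open>MC\<close> depends on the components in \<open>M\<close> alone, so those in \<open>L\<close> can be 0.\<close>
      from * have "MC [((0, u), (0, v))] (0, w) = 0"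
        by blast
      then show "defect u v w = 0"
        by (simp add: MC_single zero_prod_def)
    qed
  next
    assume *: "\<forall>u v w. defect u v w = 0"
    show "\<forall>Xs c. MC Xs c = 0"
    proof (intro allI)
      fix Xs c
      show "MC Xs c = 0"
      proof (cases "length Xs = Suc 0")
        case True
        then obtain a b where "Xs = [(a, b)]"
          by (cases Xs) auto
        with * show ?thesis
          by (simp add: MC_single zero_prod_def)
      qed (rule MC_other)
    qed
  qed
  also have "\<dots> \<longleftrightarrow> generalized_Reynolds_operator scaleL bracket scaleM \<theta> H T"
    by (simp add: generalized_Reynolds_operator_def defect_def assms(4))
  finally show ?thesis
    by simp
qed

end
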